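(* Let $(\mathcal{M},\phi,\xi,\eta,g)$ be a $(2n+1)$-dimensional Riemannian $\Pi$-manifold belonging to one of the main classes $\mathcal{F}_i$ $(i=1,4,5,11)$, let $\nabla$ be the Levi-Civita connection of $g$, and let $\dot{D}$ be the first natural connection. Then, for all vector fields $x,y$ on $\mathcal{M}$: \begin{enumerate} \item If $(\mathcal{M},\phi,\xi,\eta,g)\in\mathcal{F}_1$, then $$\dot{D}_xy=\nabla_xy-\frac{1}{4n}\left\{\theta(\phi y)\phi^2x-\theta(\phi^2y)\phi x+g(x,\phi y)\phi^2\theta^\sharp-g(\phi x,\phi y)\phi\theta^\sharp\right\},$$ where $\theta^\sharp$ is the vector field with $\theta(\cdot)=g(\theta^\sharp,\cdot)$. \item If $(\mathcal{M},\phi,\xi,\eta,g)\in\mathcal{F}_4$, then $$\dot{D}_xy=\nabla_xy-\frac{1}{2n}\theta(\xi)\left\{g(x,\phi y)\xi-\eta(y)\phi x\right\}.$$ \item If $(\mathcal{M},\phi,\xi,\eta,g)\in\mathcal{F}_5$, then $$\dot{D}_xy=\nabla_xy-\frac{1}{2n}\theta^*(\xi)\left\{g(\phi x,\phi y)\xi-\eta(y)\phi^2x\right\}.$$ \item If $(\mathcal{M},\phi,\xi,\eta,g)\in\mathcal{F}_{11}$, then $$\dot{D}_xy=\nabla_xy-\eta(x)\left\{\omega(\phi y)\xi-\eta(y)\phi\omega^\sharp\right\},$$ where $\omega^\sharp$ is the vector field with $\omega(\cdot)=g(\omega^\sharp,\cdot)$. \end{enumerate}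
   Context: A Riemannian $\Pi$-manifold $(\mathcal{M},\phi,\xi,\eta,g)$ is a $(2n+1)$-dimensional smooth manifold $\mathcal{M}$ with a Riemannian metric $g$, a $(1,1)$-tensor field $\phi$, a vector field $\xi$ and a 1-form $\eta$ such that $$\phi\xi=0,\quad \phi^2=I-\eta\otimes\xi,\quad \eta\circ\phi=0,\quad \eta(\xi)=1,\quad \operatorname{tr}\phi=0,\quad g(\phi x,\phi y)=g(x,y)-\eta(x)\eta(y).$$ Consequently $g(\phi x,y)=g(x,\phi y)$ and $g(x,\xi)=\eta(x)$. The fundamental tensor is $F(x,y,z)=g\bigl((\nabla_x\phi)y,z\bigr)$. The Lee forms are the 1-forms $$\theta=g^{ij}F(e_i,e_j,\cdot),\qquad \theta^*=g^{ij}F(e_i,\phi e_j,\cdot),\qquad \omega=F(\xi,\xi,\cdot),$$ where $\{\xi;e_1,\dots,e_{2n}\}$ is a basis of $T_p\mathcal{M}$ with $\eta(e_i)=0$, $(g^{ij})$ is the inverse matrix of $(g_{ij})$, $g_{ij}=g(e_i,e_j)$, and summation is over $i,j=1,\dots,2n$. The main classes are defined by the following conditions, required for all $x,y,z$: \begin{itemize} \item $\mathcal{F}_1$: $F(x,y,z)=\frac{1}{2n}\bigl\{g(\phi x,\phi y)\theta(\phi^2z)+g(\phi x,\phi z)\theta(\phi^2y)-g(x,\phi y)\theta(\phi z)-g(x,\phi z)\theta(\phi y)\bigr\}$; \item $\mathcal{F}_4$: $F(x,y,z)=\frac{\theta(\xi)}{2n}\bigl\{g(\phi x,\phi y)\eta(z)+g(\phi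 x,\phi z)\eta(y)\bigr\}$; \item $\mathcal{F}_5$: $F(x,y,z)=\frac{\theta^*(\xi)}{2n}\bigl\{g(x,\phi y)\eta(z)+g(x,\phi z)\eta(y)\bigr\}$; \item $\mathcal{F}_{11}$: $F(x,y,z)=\eta(x)\bigl\{\eta(y)\omega(z)+\eta(z)\omega(y)\bigr\}$. \end{itemize} The first natural connection $\dot{D}$ is the affine connection defined by $$\dot{D}_xy=\nabla_xy-\tfrac12\bigl\{(\nabla_x\phi)\phi y-(\nabla_x\eta)(y)\,\xi\bigr\}-\eta(y)\nabla_x\xi.$$ *)

theory Defs
  imports "HOL-Analysis.Analysis" "HOL-Library.Function_Algebras"
begin

text \<open>Tangent vectors are derivations, i.e. real-valued functionals on functions.  Together with
  the pointwise addition of \<^theory>\<open>HOL-Library.Function_Algebras\<close> the following instance makes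
  them elements of a real vector space, so that \<^const>\<open>span\<close>, \<^const>\<open>independent\<close> and
  \<^const>\<open>representation\<close> apply.\<close>

instantiation "fun" :: (type, real_vector) real_vector
begin

definition scaleR_fun :: "real \<Rightarrow> ('a \<Rightarrow> 'b) \<Rightarrow> 'a \<Rightarrow> 'b" where
  "scaleR_fun c f = (\<lambda>x. c *\<^sub>R f x)"

instance
  by standard (simp_all add: scaleR_fun_def fun_eq_iff scaleR_add_right scaleR_add_left)

end


section \<open>Smooth manifolds\<close>

text \<open>Both notions are meant for open \<^term>\<open>S\<close>.\<close>

primrec Ck_on :: "nat \<Rightarrow> ('e::euclidean_space \<Rightarrow> 'f::real_normed_vector) \<Rightarrow> 'e set \<Rightarrow> bool" where
  "Ck_on 0 f S \<longleftrightarrow> continuous_on S f"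
| "Ck_on (Suc k) f S \<longleftrightarrow>
     (\<forall>x\<in>S. f differentiable (at x)) \<and> (\<forall>v. Ck_on k (\<lambda>x. frechet_derivative f (at x) v) S)"

definition smooth_on :: "'e::euclidean_space set \<Rightarrow> ('e \<Rightarrow> 'f::real_normed_vector) \<Rightarrow> bool" where
  "smooth_on S f \<longleftrightarrow> (\<forall>k. Ck_on k f S)"

text \<open>The underlying space of the manifold is the whole type \<^typ>\<open>'a\<close>; in the main theorem it is
  Hausdorff and second countable by its sort.  A chart is a pair of its domain and the coordinate
  map; the values of the coordinate map outside the domain are irrelevant.\<close>

type_synonym ('a, 'e) atlas = "('a set \<times> ('a \<Rightarrow> 'e)) set"

definition smooth_atlas :: "('a::topological_space, 'e::euclidean_space) atlas \<Rightarrow> bool" where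
  "smooth_atlas A \<longleftrightarrow>
     (\<forall>(U, c)\<in>A. open U \<and> open (c ` U) \<and> (\<exists>c'. homeomorphism U (c ` U) c c')) \<and>
     (\<Union>(U, c)\<in>A. U) = UNIV \<and>
     (\<forall>(U, c)\<in>A. \<forall>(V, d)\<in>A. smooth_on (c ` (U \<inter> V)) (d \<circ> inv_into U c))"

definition smooth_functions :: "('a::topological_space, 'e::euclidean_space) atlas \<Rightarrow> ('a \<Rightarrow> real) set" where
  "smooth_functions A = {f. \<forall>(U, c)\<in>A. smooth_on (c ` U) (f \<circ> inv_into U c)}"

type_synonym 'a tangent = "('a \<Rightarrow> real) \<Rightarrow> real"
type_synonym 'a vfield = "'a \<Rightarrow> 'a tangent"

text \<open>Derivations at \<^term>\<open>p\<close> of the algebra of smooth functions.  Requiring the value \<^term>\<open>0\<close> on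
  non-smooth functions makes a derivation determined by its values on smooth ones.\<close>

definition tangent_space :: "('a::topological_space, 'e::euclidean_space) atlas \<Rightarrow> 'a \<Rightarrow> 'a tangent set" where
  "tangent_space A p = {v.
     (\<forall>f. f \<notin> smooth_functions A \<longrightarrow> v f = 0) \<and>
     (\<forall>f\<in>smooth_functions A. \<forall>h\<in>smooth_functions A. \<forall>a b.
        v (\<lambda>q. a * f q + b * h q) = a * v f + b * v h) \<and>
     (\<forall>f\<in>smooth_functions A. \<forall>h\<in>smooth_functions A.
        v (\<lambda>q. f q * h q) = f p * v h + h p * v f)}"

definition vector_fields :: "('a::topological_space, 'e::euclidean_space) atlas \<Rightarrow> 'a vfield set" where
  "vector_fields A = {X. (\<forall>p. X p \<in> tangent_space A p) \<and>
     (\<forall>f\<in>smooth_functions A. (\<lambda>p. X p f) \<in> smooth_functions A)}"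

definition deriv_along :: "'a vfield \<Rightarrow> ('a \<Rightarrow> real) \<Rightarrow> 'a \<Rightarrow> real" where
  "deriv_along X f = (\<lambda>p. X p f)"

definition lie_bracket :: "'a vfield \<Rightarrow> 'a vfield \<Rightarrow> 'a vfield" where
  "lie_bracket X Y = (\<lambda>p f. X p (deriv_along Y f) - Y p (deriv_along X f))"

text \<open>Tensor fields are families of (multi)linear maps on the tangent spaces which send smooth vector
  fields to smooth objects.  A field \<^term>\<open>T\<close> of 1-forms or of endomorphisms acts on vector fields
  pointwise.\<close>

definition on_field :: "('a \<Rightarrow> 'a tangent \<Rightarrow> 'b) \<Rightarrow> 'a vfield \<Rightarrow> 'a \<Rightarrow> 'b" (infixr "\<odot>" 90) where
  "T \<odot> X = (\<lambda>p. T p (X p))"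

definition linear_on_subspace :: "'v::real_vector set \<Rightarrow> ('v \<Rightarrow> 'w::real_vector) \<Rightarrow> bool" where
  "linear_on_subspace V L \<longleftrightarrow>
     (\<forall>u\<in>V. \<forall>v\<in>V. \<forall>a b. L (a *\<^sub>R u + b *\<^sub>R v) = a *\<^sub>R L u + b *\<^sub>R L v)"

definition one_form :: "('a::topological_space, 'e::euclidean_space) atlas
    \<Rightarrow> ('a \<Rightarrow> 'a tangent \<Rightarrow> real) \<Rightarrow> bool" where
  "one_form A \<alpha> \<longleftrightarrow> (\<forall>p. linear_on_subspace (tangent_space A p) (\<alpha> p)) \<and>
     (\<forall>X\<in>vector_fields A. \<alpha> \<odot> X \<in> smooth_functions A)"

definition endomorphism_field :: "('a::topological_space, 'e::euclidean_space) atlas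
    \<Rightarrow> ('a \<Rightarrow> 'a tangent \<Rightarrow> 'a tangent) \<Rightarrow> bool" where
  "endomorphism_field A T \<longleftrightarrow>
     (\<forall>p. linear_on_subspace (tangent_space A p) (T p) \<and> T p ` tangent_space A p \<subseteq> tangent_space A p) \<and>
     (\<forall>X\<in>vector_fields A. T \<odot> X \<in> vector_fields A)"

definition trace_on :: "'v::real_vector set \<Rightarrow> ('v \<Rightarrow> 'v) \<Rightarrow> real" where
  "trace_on V L = (let B = (SOME B. independent B \<and> span B = V) in \<Sum>b\<in>B. representation B (L b) b)"

definition riemannian_metric :: "('a::topological_space, 'e::euclidean_space) atlas
    \<Rightarrow> ('a \<Rightarrow> 'a tangent \<Rightarrow> 'a tangent \<Rightarrow> real) \<Rightarrow> bool" where
  "riemannian_metric A g \<longleftrightarrow>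
     (\<forall>p. \<forall>u\<in>tangent_space A p. linear_on_subspace (tangent_space A p) (g p u)) \<and>
     (\<forall>p. \<forall>u\<in>tangent_space A p. \<forall>v\<in>tangent_space A p. g p u v = g p v u) \<and>
     (\<forall>p. \<forall>u\<in>tangent_space A p. u \<noteq> 0 \<longrightarrow> g p u u > 0) \<and>
     (\<forall>X\<in>vector_fields A. \<forall>Y\<in>vector_fields A. (\<lambda>p. g p (X p) (Y p)) \<in> smooth_functions A)"

type_synonym 'a connection = "'a vfield \<Rightarrow> 'a vfield \<Rightarrow> 'a vfield"

definition affine_connection :: "('a::topological_space, 'e::euclidean_space) atlas
    \<Rightarrow> 'a connection \<Rightarrow> bool" where
  "affine_connection A nabla \<longleftrightarrow>
     (\<forall>X\<in>vector_fields A. \<forall>Y\<in>vector_fields A. nabla X Y \<in> vector_fields A) \<and>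
     (\<forall>X\<in>vector_fields A. \<forall>X'\<in>vector_fields A. \<forall>Y\<in>vector_fields A.
        nabla (\<lambda>p. X p + X' p) Y = (\<lambda>p. nabla X Y p + nabla X' Y p)) \<and>
     (\<forall>f\<in>smooth_functions A. \<forall>X\<in>vector_fields A. \<forall>Y\<in>vector_fields A.
        nabla (\<lambda>p. f p *\<^sub>R X p) Y = (\<lambda>p. f p *\<^sub>R nabla X Y p)) \<and>
     (\<forall>X\<in>vector_fields A. \<forall>Y\<in>vector_fields A. \<forall>Y'\<in>vector_fields A.
        nabla X (\<lambda>p. Y p + Y' p) = (\<lambda>p. nabla X Y p + nabla X Y' p)) \<and>
     (\<forall>f\<in>smooth_functions A. \<forall>X\<in>vector_fields A. \<forall>Y\<in>vector_fields A.
        nabla X (\<lambda>p. f p *\<^sub>R Y p) = (\<lambda>p. deriv_along X f p *\<^sub>R Y p + f p *\<^sub>R nabla X Y p))"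

definition levi_civita :: "('a::topological_space, 'e::euclidean_space) atlas
    \<Rightarrow> ('a \<Rightarrow> 'a tangent \<Rightarrow> 'a tangent \<Rightarrow> real) \<Rightarrow> 'a connection \<Rightarrow> bool" where
  "levi_civita A g nabla \<longleftrightarrow> affine_connection A nabla \<and>
     (\<forall>X\<in>vector_fields A. \<forall>Y\<in>vector_fields A.
        (\<lambda>p. nabla X Y p - nabla Y X p) = lie_bracket X Y) \<and>
     (\<forall>X\<in>vector_fields A. \<forall>Y\<in>vector_fields A. \<forall>Z\<in>vector_fields A.
        deriv_along X (\<lambda>p. g p (Y p) (Z p)) =
          (\<lambda>p. g p (nabla X Y p) (Z p) + g p (Y p) (nabla X Z p)))"

definition cov_endo :: "'a connection \<Rightarrow> ('a \<Rightarrow> 'a tangent \<Rightarrow> 'a tangent) \<Rightarrow> 'a vfield \<Rightarrow> 'a vfield \<Rightarrow> 'a vfield" where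
  "cov_endo nabla T X Y = (\<lambda>p. nabla X (T \<odot> Y) p - T p (nabla X Y p))"

definition cov_form :: "'a connection \<Rightarrow> ('a \<Rightarrow> 'a tangent \<Rightarrow> real) \<Rightarrow> 'a vfield \<Rightarrow> 'a vfield \<Rightarrow> 'a \<Rightarrow> real" where
  "cov_form nabla \<alpha> X Y = (\<lambda>p. deriv_along X (\<alpha> \<odot> Y) p - \<alpha> p (nabla X Y p))"


section \<open>Riemannian \<open>\<Pi>\<close>-manifolds\<close>

definition riemannian_Pi_manifold :: "('a::topological_space, 'e::euclidean_space) atlas \<Rightarrow> nat
    \<Rightarrow> ('a \<Rightarrow> 'a tangent \<Rightarrow> 'a tangent) \<Rightarrow> 'a vfield \<Rightarrow> ('a \<Rightarrow> 'a tangent \<Rightarrow> real)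
    \<Rightarrow> ('a \<Rightarrow> 'a tangent \<Rightarrow> 'a tangent \<Rightarrow> real) \<Rightarrow> bool" where
  "riemannian_Pi_manifold A n \<phi> \<xi> \<eta> g \<longleftrightarrow>
     smooth_atlas A \<and> DIM('e) = 2 * n + 1 \<and>
     riemannian_metric A g \<and> endomorphism_field A \<phi> \<and> \<xi> \<in> vector_fields A \<and> one_form A \<eta> \<and>
     (\<forall>p. \<phi> p (\<xi> p) = 0 \<and> \<eta> p (\<xi> p) = 1 \<and> trace_on (tangent_space A p) (\<phi> p) = 0 \<and>
       (\<forall>u\<in>tangent_space A p.
          \<phi> p (\<phi> p u) = u - \<eta> p u *\<^sub>R \<xi> p \<and> \<eta> p (\<phi> p u) = 0 \<and>
          (\<forall>v\<in>tangent_space A p. g p (\<phi> p u) (\<phi> p v) = g p u v - \<eta> p u * \<eta> p v)))"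

definition fundamental_tensor :: "('a \<Rightarrow> 'a tangent \<Rightarrow> 'a tangent) \<Rightarrow> ('a \<Rightarrow> 'a tangent \<Rightarrow> 'a tangent \<Rightarrow> real)
    \<Rightarrow> 'a connection \<Rightarrow> 'a vfield \<Rightarrow> 'a vfield \<Rightarrow> 'a vfield \<Rightarrow> 'a \<Rightarrow> real" where
  "fundamental_tensor \<phi> g nabla X Y Z = (\<lambda>p. g p (cov_endo nabla \<phi> X Y p) (Z p))"

definition inverse_entries :: "nat \<Rightarrow> (nat \<Rightarrow> nat \<Rightarrow> real) \<Rightarrow> nat \<Rightarrow> nat \<Rightarrow> real" where
  "inverse_entries m a = (SOME b. \<forall>i<m. \<forall>k<m. (\<Sum>j<m. b i j * a j k) = (if i = k then 1 else 0))"

text \<open>The basis vectors \<open>e\<^sub>i\<close> at \<^term>\<open>p\<close> are given as values of vector fields, so that \<open>F\<close>, whose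
  arguments are vector fields, can be evaluated on them.\<close>

definition adapted_basis_at :: "('a::topological_space, 'e::euclidean_space) atlas \<Rightarrow> nat \<Rightarrow> 'a vfield
    \<Rightarrow> ('a \<Rightarrow> 'a tangent \<Rightarrow> real) \<Rightarrow> 'a \<Rightarrow> (nat \<Rightarrow> 'a vfield) \<Rightarrow> bool" where
  "adapted_basis_at A n \<xi> \<eta> p E \<longleftrightarrow>
     (\<forall>i<2 * n. E i \<in> vector_fields A \<and> \<eta> p (E i p) = 0) \<and>
     inj_on (\<lambda>i. E i p) {..<2 * n} \<and>
     independent (insert (\<xi> p) ((\<lambda>i. E i p) ` {..<2 * n})) \<and>
     span (insert (\<xi> p) ((\<lambda>i. E i p) ` {..<2 * n})) = tangent_space A p"

text \<open>\<open>g\<^sup>i\<^sup>j T(e\<^sub>i, e\<^sub>j)\<close>; for tensorial \<^term>\<open>T\<close> the value depends neither on the basis nor on the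
  vector fields extending it.\<close>

definition horizontal_trace :: "('a::topological_space, 'e::euclidean_space) atlas \<Rightarrow> nat \<Rightarrow> 'a vfield
    \<Rightarrow> ('a \<Rightarrow> 'a tangent \<Rightarrow> real) \<Rightarrow> ('a \<Rightarrow> 'a tangent \<Rightarrow> 'a tangent \<Rightarrow> real)
    \<Rightarrow> ('a vfield \<Rightarrow> 'a vfield \<Rightarrow> 'a \<Rightarrow> real) \<Rightarrow> 'a \<Rightarrow> real" where
  "horizontal_trace A n \<xi> \<eta> g T p =
     (let E = (SOME E. adapted_basis_at A n \<xi> \<eta> p E);
          h = inverse_entries (2 * n) (\<lambda>i j. g p (E i p) (E j p))
      in \<Sum>i<2 * n. \<Sum>j<2 * n. h i j * T (E i) (E j) p)"

definition lee_theta :: "('a::topological_space, 'e::euclidean_space) atlas \<Rightarrow> nat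
    \<Rightarrow> ('a \<Rightarrow> 'a tangent \<Rightarrow> 'a tangent) \<Rightarrow> 'a vfield \<Rightarrow> ('a \<Rightarrow> 'a tangent \<Rightarrow> real)
    \<Rightarrow> ('a \<Rightarrow> 'a tangent \<Rightarrow> 'a tangent \<Rightarrow> real) \<Rightarrow> 'a connection \<Rightarrow> 'a vfield \<Rightarrow> 'a \<Rightarrow> real" where
  "lee_theta A n \<phi> \<xi> \<eta> g nabla Z =
     horizontal_trace A n \<xi> \<eta> g (\<lambda>X Y. fundamental_tensor \<phi> g nabla X Y Z)"

definition lee_theta_star :: "('a::topological_space, 'e::euclidean_space) atlas \<Rightarrow> nat
    \<Rightarrow> ('a \<Rightarrow> 'a tangent \<Rightarrow> 'a tangent) \<Rightarrow> 'a vfield \<Rightarrow> ('a \<Rightarrow> 'a tangent \<Rightarrow> real)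
    \<Rightarrow> ('a \<Rightarrow> 'a tangent \<Rightarrow> 'a tangent \<Rightarrow> real) \<Rightarrow> 'a connection \<Rightarrow> 'a vfield \<Rightarrow> 'a \<Rightarrow> real" where
  "lee_theta_star A n \<phi> \<xi> \<eta> g nabla Z =
     horizontal_trace A n \<xi> \<eta> g (\<lambda>X Y. fundamental_tensor \<phi> g nabla X (\<phi> \<odot> Y) Z)"

definition lee_omega :: "('a \<Rightarrow> 'a tangent \<Rightarrow> 'a tangent) \<Rightarrow> 'a vfield
    \<Rightarrow> ('a \<Rightarrow> 'a tangent \<Rightarrow> 'a tangent \<Rightarrow> real) \<Rightarrow> 'a connection \<Rightarrow> 'a vfield \<Rightarrow> 'a \<Rightarrow> real" where
  "lee_omega \<phi> \<xi> g nabla Z = fundamental_tensor \<phi> g nabla \<xi> \<xi> Z"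

text \<open>The vector field metrically dual to a 1-form that is given as a function of vector fields.\<close>

definition is_sharp :: "('a::topological_space, 'e::euclidean_space) atlas
    \<Rightarrow> ('a \<Rightarrow> 'a tangent \<Rightarrow> 'a tangent \<Rightarrow> real) \<Rightarrow> ('a vfield \<Rightarrow> 'a \<Rightarrow> real) \<Rightarrow> 'a vfield \<Rightarrow> bool" where
  "is_sharp A g \<alpha> W \<longleftrightarrow> W \<in> vector_fields A \<and>
     (\<forall>Z\<in>vector_fields A. \<forall>p. \<alpha> Z p = g p (W p) (Z p))"

definition class_F1 :: "('a::topological_space, 'e::euclidean_space) atlas \<Rightarrow> nat
    \<Rightarrow> ('a \<Rightarrow> 'a tangent \<Rightarrow> 'a tangent) \<Rightarrow> 'a vfield \<Rightarrow> ('a \<Rightarrow> 'a tangent \<Rightarrow> real)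
    \<Rightarrow> ('a \<Rightarrow> 'a tangent \<Rightarrow> 'a tangent \<Rightarrow> real) \<Rightarrow> 'a connection \<Rightarrow> bool" where
  "class_F1 A n \<phi> \<xi> \<eta> g nabla \<longleftrightarrow>
     (let \<theta> = lee_theta A n \<phi> \<xi> \<eta> g nabla in
      \<forall>x\<in>vector_fields A. \<forall>y\<in>vector_fields A. \<forall>z\<in>vector_fields A. \<forall>p.
        fundamental_tensor \<phi> g nabla x y z p = 1 / (2 * real n) *
          (g p (\<phi> p (x p)) (\<phi> p (y p)) * \<theta> (\<phi> \<odot> \<phi> \<odot> z) p
         + g p (\<phi> p (x p)) (\<phi> p (z p)) * \<theta> (\<phi> \<odot> \<phi> \<odot> y) p
         - g p (x p) (\<phi> p (y p)) * \<theta> (\<phi> \<odot> z) p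
         - g p (x p) (\<phi> p (z p)) * \<theta> (\<phi> \<odot> y) p))"

definition class_F4 :: "('a::topological_space, 'e::euclidean_space) atlas \<Rightarrow> nat
    \<Rightarrow> ('a \<Rightarrow> 'a tangent \<Rightarrow> 'a tangent) \<Rightarrow> 'a vfield \<Rightarrow> ('a \<Rightarrow> 'a tangent \<Rightarrow> real)
    \<Rightarrow> ('a \<Rightarrow> 'a tangent \<Rightarrow> 'a tangent \<Rightarrow> real) \<Rightarrow> 'a connection \<Rightarrow> bool" where
  "class_F4 A n \<phi> \<xi> \<eta> g nabla \<longleftrightarrow>
     (\<forall>x\<in>vector_fields A. \<forall>y\<in>vector_fields A. \<forall>z\<in>vector_fields A. \<forall>p.
        fundamental_tensor \<phi> g nabla x y z p =
          lee_theta A n \<phi> \<xi> \<eta> g nabla \<xi> p / (2 * real n) *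
          (g p (\<phi> p (x p)) (\<phi> p (y p)) * \<eta> p (z p)
         + g p (\<phi> p (x p)) (\<phi> p (z p)) * \<eta> p (y p)))"

definition class_F5 :: "('a::topological_space, 'e::euclidean_space) atlas \<Rightarrow> nat
    \<Rightarrow> ('a \<Rightarrow> 'a tangent \<Rightarrow> 'a tangent) \<Rightarrow> 'a vfield \<Rightarrow> ('a \<Rightarrow> 'a tangent \<Rightarrow> real)
    \<Rightarrow> ('a \<Rightarrow> 'a tangent \<Rightarrow> 'a tangent \<Rightarrow> real) \<Rightarrow> 'a connection \<Rightarrow> bool" where
  "class_F5 A n \<phi> \<xi> \<eta> g nabla \<longleftrightarrow>
     (\<forall>x\<in>vector_fields A. \<forall>y\<in>vector_fields A. \<forall>z\<in>vector_fields A. \<forall>p.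
        fundamental_tensor \<phi> g nabla x y z p =
          lee_theta_star A n \<phi> \<xi> \<eta> g nabla \<xi> p / (2 * real n) *
          (g p (x p) (\<phi> p (y p)) * \<eta> p (z p)
         + g p (x p) (\<phi> p (z p)) * \<eta> p (y p)))"

definition class_F11 :: "('a::topological_space, 'e::euclidean_space) atlas
    \<Rightarrow> ('a \<Rightarrow> 'a tangent \<Rightarrow> 'a tangent) \<Rightarrow> 'a vfield \<Rightarrow> ('a \<Rightarrow> 'a tangent \<Rightarrow> real)
    \<Rightarrow> ('a \<Rightarrow> 'a tangent \<Rightarrow> 'a tangent \<Rightarrow> real) \<Rightarrow> 'a connection \<Rightarrow> bool" where
  "class_F11 A \<phi> \<xi> \<eta> g nabla \<longleftrightarrow>
     (let \<omega> = lee_omega \<phi> \<xi> g nabla in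
      \<forall>x\<in>vector_fields A. \<forall>y\<in>vector_fields A. \<forall>z\<in>vector_fields A. \<forall>p.
        fundamental_tensor \<phi> g nabla x y z p =
          \<eta> p (x p) * (\<eta> p (y p) * \<omega> z p + \<eta> p (z p) * \<omega> y p))"

definition first_natural_connection :: "('a \<Rightarrow> 'a tangent \<Rightarrow> 'a tangent) \<Rightarrow> 'a vfield
    \<Rightarrow> ('a \<Rightarrow> 'a tangent \<Rightarrow> real) \<Rightarrow> 'a connection \<Rightarrow> 'a connection" where
  "first_natural_connection \<phi> \<xi> \<eta> nabla x y = (\<lambda>p.
     nabla x y p
     - (1/2) *\<^sub>R (cov_endo nabla \<phi> x (\<phi> \<odot> y) p - cov_form nabla \<eta> x y p *\<^sub>R \<xi> p)
     - \<eta> p (y p) *\<^sub>R nabla x \<xi> p)"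

end

theory Submission
  imports Defs
begin

text \<open>Since \<open>\<eta>(y) = g(y, \<xi>)\<close> and \<open>g(\<nabla>\<^sub>x\<xi>, \<xi>) = 0\<close>, differentiating \<open>\<phi>\<xi> = 0\<close> gives
  \<open>\<nabla>\<^sub>x\<xi> = -\<phi>((\<nabla>\<^sub>x\<phi>)\<xi>)\<close> and \<open>(\<nabla>\<^sub>x\<eta>)(y) = g(\<nabla>\<^sub>x\<xi>, y) = -F(x, \<xi>, \<phi>y)\<close>.  Hence the tensor
  \<open>D - \<nabla>\<close> of the first natural connection is determined by \<open>F\<close>, namely
  \<open>g(D\<^sub>xy - \<nabla>\<^sub>xy, z) = -1/2 F(x, \<phi>y, z) - 1/2 F(x, \<xi>, \<phi>y) \<eta>(z) + \<eta>(y) F(x, \<xi>, \<phi>z)\<close>,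
  and the four formulas result from inserting the defining condition of each class.\<close>

section \<open>Tangent spaces and the pointwise algebra of \<open>\<phi>\<close>,
  \<open>\<eta>\<close> and \<open>g\<close>\<close>

lemma subspace_tangent_space: "subspace (tangent_space A p)"
  unfolding subspace_def tangent_space_def
  by (auto simp: zero_fun_def plus_fun_def scaleR_fun_def algebra_simps)

locale Pi_manifold =
  fixes A :: "('a::topological_space, 'e::euclidean_space) atlas"
    and n :: nat
    and \<phi> :: "'a \<Rightarrow> 'a tangent \<Rightarrow> 'a tangent"
    and \<xi> :: "'a vfield"
    and \<eta> :: "'a \<Rightarrow> 'a tangent \<Rightarrow> real"
    and g :: "'a \<Rightarrow> 'a tangent \<Rightarrow> 'a tangent \<Rightarrow> real"
    and nabla :: "'a connection"
  assumes Pi: "riemannian_Pi_manifold A n \<phi> \<xi> \<eta> g"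
    and LC: "levi_civita A g nabla"
begin

abbreviation "VF \<equiv> vector_fields A"
abbreviation "T \<equiv> tangent_space A"
abbreviation "F \<equiv> fundamental_tensor \<phi> g nabla"

lemma T_closed [simp]:
  "0 \<in> T p"
  "u \<in> T p \<Longrightarrow> v \<in> T p \<Longrightarrow> u + v \<in> T p"
  "u \<in> T p \<Longrightarrow> v \<in> T p \<Longrightarrow> u - v \<in> T p"
  "u \<in> T p \<Longrightarrow> - u \<in> T p"
  "u \<in> T p \<Longrightarrow> c *\<^sub>R u \<in> T p"
  using subspace_tangent_space[of A p]
  by (simp_all add: subspace_0 subspace_add subspace_diff subspace_neg subspace_scale)

lemma VF_T [simp]: "X \<in> VF \<Longrightarrow> X p \<in> T p"
  by (simp add: vector_fields_def)

lemma xi_VF [simp]: "\<xi> \<in> VF"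
  using Pi by (simp add: riemannian_Pi_manifold_def)

lemma phi_VF [simp]: "X \<in> VF \<Longrightarrow> \<phi> \<odot> X \<in> VF"
  using Pi by (simp add: riemannian_Pi_manifold_def endomorphism_field_def)

lemma nabla_VF [simp]: "X \<in> VF \<Longrightarrow> Y \<in> VF \<Longrightarrow> nabla X Y \<in> VF"
  using LC by (simp add: levi_civita_def affine_connection_def)

lemma phi_T [simp]: "u \<in> T p \<Longrightarrow> \<phi> p u \<in> T p"
  using Pi by (auto simp: riemannian_Pi_manifold_def endomorphism_field_def)

lemma g_commute: "u \<in> T p \<Longrightarrow> v \<in> T p \<Longrightarrow> g p u v = g p v u"
  using Pi by (simp add: riemannian_Pi_manifold_def riemannian_metric_def)

lemma g_pos: "u \<in> T p \<Longrightarrow> u \<noteq> 0 \<Longrightarrow> g p u u > 0"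
  using Pi by (simp add: riemannian_Pi_manifold_def riemannian_metric_def)

lemma g_linear_right:
  "u \<in> T p \<Longrightarrow> v \<in> T p \<Longrightarrow> w \<in> T p \<Longrightarrow> g p u (a *\<^sub>R v + b *\<^sub>R w) = a * g p u v + b * g p u w"
  using Pi by (simp add: riemannian_Pi_manifold_def riemannian_metric_def linear_on_subspace_def)

lemma g_linear_left:
  "u \<in> T p \<Longrightarrow> v \<in> T p \<Longrightarrow> w \<in> T p \<Longrightarrow> g p (a *\<^sub>R v + b *\<^sub>R w) u = a * g p v u + b * g p w u"
  using g_linear_right[of u p v w a b] by (simp add: g_commute)

lemma g_left [simp]:
  assumes "w \<in> T p" "u \<in> T p"
  shows "v \<in> T p \<Longrightarrow> g p (u + v) w = g p u w + g p v w"
    and "v \<in> T p \<Longrightarrow> g p (u - v) w = g p u w - g p v w"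
    and "g p (c *\<^sub>R u) w = c * g p u w"
    and "g p (- u) w = - g p u w"
  using assms g_linear_left[of w p u _ 1 1] g_linear_left[of w p u _ 1 "-1"]
    g_linear_left[of w p u u c 0] g_linear_left[of w p u u "-1" 0]
  by simp_all

lemma g_zero [simp]: "u \<in> T p \<Longrightarrow> g p 0 u = 0" "u \<in> T p \<Longrightarrow> g p u 0 = 0"
  using g_linear_left[of u p u u 0 0] g_linear_right[of u p u u 0 0] by simp_all

lemma phi_xi [simp]: "\<phi> p (\<xi> p) = 0"
  and eta_xi [simp]: "\<eta> p (\<xi> p) = 1"
  and phi_phi: "u \<in> T p \<Longrightarrow> \<phi> p (\<phi> p u) = u - \<eta> p u *\<^sub>R \<xi> p"
  and eta_phi [simp]: "u \<in> T p \<Longrightarrow> \<eta> p (\<phi> p u) = 0"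
  and g_phi_phi: "u \<in> T p \<Longrightarrow> v \<in> T p \<Longrightarrow> g p (\<phi> p u) (\<phi> p v) = g p u v - \<eta> p u * \<eta> p v"
  using Pi by (simp_all add: riemannian_Pi_manifold_def)

text \<open>Metric compatibility with one argument equal to \<open>\<xi>\<close>: the left side
  vanishes because \<open>\<phi>\<close> annihilates \<open>\<xi>\<close>.\<close>

lemma g_xi [simp]: "u \<in> T p \<Longrightarrow> g p u (\<xi> p) = \<eta> p u" "u \<in> T p \<Longrightarrow> g p (\<xi> p) u = \<eta> p u"
  using g_phi_phi[of u p "\<xi> p"] by (simp_all add: g_commute)

text \<open>Here \<open>0\<close> is read as the image of \<open>\<xi>\<close>, and the square of
  \<open>\<phi>\<close> kills \<open>\<xi>\<close> since \<open>\<eta>\<close> takes the value 1 on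
  it.\<close>

lemma phi_zero [simp]: "\<phi> p 0 = 0"
  using phi_phi[of "\<xi> p" p] by simp

text \<open>Metric compatibility for \<open>\<phi> p u\<close> and \<open>v\<close>: the square of
  \<open>\<phi>\<close> removes only the \<open>\<xi>\<close>-component of \<open>u\<close>, and
  \<open>\<xi>\<close> is orthogonal to the image of \<open>\<phi>\<close>.\<close>

lemma g_phi_left: "u \<in> T p \<Longrightarrow> v \<in> T p \<Longrightarrow> g p (\<phi> p u) v = g p u (\<phi> p v)"
  using g_phi_phi[of "\<phi> p u" p v] by (simp add: phi_phi)

lemma phi_phi_phi [simp]: "u \<in> T p \<Longrightarrow> \<phi> p (\<phi> p (\<phi> p u)) = \<phi> p u"
  using phi_phi[of "\<phi> p u" p] by simp

lemma on_field_apply [simp]: "(\<phi> \<odot> X) p = \<phi> p (X p)"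
  by (simp add: on_field_def)

text \<open>The class conditions are only available for values of vector fields, hence the test vectors
  \<open>Z p\<close> and the restriction to their span.\<close>

lemma eq_by_metric:
  assumes "v \<in> span {X p |X. X \<in> VF}" "w \<in> span {X p |X. X \<in> VF}"
    and eq: "\<And>Z. Z \<in> VF \<Longrightarrow> g p v (Z p) = g p w (Z p)"
  shows "v = w"
proof -
  let ?S = "{X p |X. X \<in> VF}"
  have sub: "span ?S \<subseteq> T p"
    by (rule span_minimal) (auto simp: subspace_tangent_space)
  define d where "d = v - w"
  have d: "d \<in> span ?S" "d \<in> T p"
    using assms(1,2) sub by (auto simp: d_def intro: span_diff)
  \<comment> \<open>The orthogonal complement of \<open>d\<close> contains all test vectors and
    hence their span, in which \<open>d\<close> itself lies; positivity of \<open>g\<close> then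
    forces \<open>d = 0\<close>.\<close>
  have "subspace {u \<in> T p. g p d u = 0}"
    using d(2) g_linear_right[of d p _ _ 1 1] g_linear_right[of d p _ 0 _ 0]
    by (simp add: subspace_def)
  moreover have "?S \<subseteq> {u \<in> T p. g p d u = 0}"
    using eq assms(1,2)[THEN subsetD[OF sub]] by (auto simp: d_def)
  ultimately have "g p d d = 0"
    using d(1) span_minimal by blast
  then have "d = 0"
    using d(2) g_pos[of d p] by force
  then show ?thesis by (simp add: d_def)
qed

section \<open>Covariant derivatives of \<open>\<xi>\<close> and \<open>\<eta>\<close>\<close>

lemma nabla_metric:
  assumes "X \<in> VF" "Y \<in> VF" "Z \<in> VF"
  shows "deriv_along X (\<lambda>p. g p (Y p) (Z p)) p = g p (nabla X Y p) (Z p) + g p (Y p) (nabla X Z p)"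
proof -
  have "deriv_along X (\<lambda>p. g p (Y p) (Z p))
      = (\<lambda>p. g p (nabla X Y p) (Z p) + g p (Y p) (nabla X Z p))"
    using assms LC by (simp add: levi_civita_def)
  then show ?thesis by (rule fun_cong)
qed

text \<open>The Leibniz rule for 1 * 1 doubles the derivative. Smoothness of the constant 1 comes
  from its being \<open>\<eta> \<odot> \<xi>\<close>.\<close>

lemma deriv_along_one: "X \<in> VF \<Longrightarrow> deriv_along X (\<lambda>p. 1) p = 0"
proof -
  assume X: "X \<in> VF"
  have "\<eta> \<odot> \<xi> \<in> smooth_functions A"
    using Pi xi_VF by (simp add: riemannian_Pi_manifold_def one_form_def)
  moreover have "\<eta> \<odot> \<xi> = (\<lambda>p. 1)"
    by (simp add: on_field_def)
  ultimately have "(\<lambda>p. 1) \<in> smooth_functions A" by simp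
  moreover have "\<forall>f\<in>smooth_functions A. \<forall>h\<in>smooth_functions A.
      X p (\<lambda>q. f q * h q) = f p * X p h + h p * X p f"
    using VF_T[OF X, of p] by (simp add: tangent_space_def)
  ultimately have "X p (\<lambda>q. 1 * 1) = 1 * X p (\<lambda>q. 1) + 1 * X p (\<lambda>q. 1)"
    by fast
  then show ?thesis by (simp add: deriv_along_def)
qed

text \<open>Differentiate the constant function g(\<xi>, \<xi>) = 1.\<close>

lemma eta_nabla_xi [simp]: "X \<in> VF \<Longrightarrow> \<eta> p (nabla X \<xi> p) = 0"
  using nabla_metric[of X \<xi> \<xi> p] deriv_along_one[of X p] by simp

text \<open>The field \<open>\<phi> \<odot> \<xi>\<close> is zero, so it equals its own double, and
  additivity of \<open>nabla\<close> makes the derivative equal to its own double too.\<close>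

lemma nabla_zero: "X \<in> VF \<Longrightarrow> nabla X (\<phi> \<odot> \<xi>) p = 0"
proof -
  assume X: "X \<in> VF"
  have "nabla X (\<lambda>p. (\<phi> \<odot> \<xi>) p + (\<phi> \<odot> \<xi>) p)
      = (\<lambda>p. nabla X (\<phi> \<odot> \<xi>) p + nabla X (\<phi> \<odot> \<xi>) p)"
    using LC X phi_VF[OF xi_VF] unfolding levi_civita_def affine_connection_def by blast
  moreover have "(\<lambda>p. (\<phi> \<odot> \<xi>) p + (\<phi> \<odot> \<xi>) p) = \<phi> \<odot> \<xi>"
    by (rule ext) simp
  ultimately show ?thesis
    by (metis add_cancel_right_right)
qed

text \<open>The covariant derivative of \<open>\<phi>\<close> at \<open>\<xi>\<close> is the
  negative of \<phi>(\<nabla>\<xi>). Pairing with \<phi>Z recovers \<nabla>\<xi> by metric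
  compatibility, because \<nabla>\<xi> has no \<open>\<xi>\<close>-component.\<close>

lemma g_nabla_xi:
  assumes "X \<in> VF" "Z \<in> VF"
  shows "g p (nabla X \<xi> p) (Z p) = - F X \<xi> (\<phi> \<odot> Z) p"
  using assms by (simp add: fundamental_tensor_def cov_endo_def nabla_zero g_phi_phi)

text \<open>As \<eta>(Y) = g(Y, \<xi>) and the metric is parallel, the terms with \<nabla>Y cancel
  and g(Y, \<nabla>\<xi>) remains.\<close>

lemma cov_form_eta:
  assumes "X \<in> VF" "Y \<in> VF"
  shows "cov_form nabla \<eta> X Y p = - F X \<xi> (\<phi> \<odot> Y) p"
proof -
  have "\<eta> \<odot> Y = (\<lambda>p. g p (Y p) (\<xi> p))"
    using assms by (simp add: on_field_def)
  then show ?thesis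
    using assms nabla_metric[of X Y \<xi> p] g_nabla_xi[of X Y p]
    by (simp add: cov_form_def g_commute)
qed

section \<open>The difference tensor of the two connections\<close>

text \<open>This is the metric product of \<nabla>XY - DXY with Z, expressed through
  \<open>F\<close>; the sign is chosen so that it describes the vector subtracted in the four
  formulas.\<close>

definition natural_difference :: "'a vfield \<Rightarrow> 'a vfield \<Rightarrow> 'a vfield \<Rightarrow> 'a \<Rightarrow> real" where
  "natural_difference X Y Z p =
     1/2 * F X (\<phi> \<odot> Y) Z p + 1/2 * F X \<xi> (\<phi> \<odot> Y) p * \<eta> p (Z p)
     - \<eta> p (Y p) * F X \<xi> (\<phi> \<odot> Z) p"

text \<open>Common reduction for all classes: the subtracted vector \<open>W\<close> is identified
  by its metric products with values of vector fields. The span condition on \<open>W\<close> is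
  what \<open>eq_by_metric\<close> demands.\<close>

lemma first_natural_connectionI:
  assumes X: "X \<in> VF" and Y: "Y \<in> VF"
    and W: "W \<in> span {X p |X. X \<in> VF}"
    and eq: "\<And>Z. Z \<in> VF \<Longrightarrow> g p W (Z p) = natural_difference X Y Z p"
  shows "first_natural_connection \<phi> \<xi> \<eta> nabla X Y p = nabla X Y p - W"
proof -
  let ?S = "{X p |X. X \<in> VF}"
  have base: "Z p \<in> span ?S" if "Z \<in> VF" for Z
    using that by (auto intro: span_base)
  define V where "V = (1/2) *\<^sub>R (cov_endo nabla \<phi> X (\<phi> \<odot> Y) p - cov_form nabla \<eta> X Y p *\<^sub>R \<xi> p)
     + \<eta> p (Y p) *\<^sub>R nabla X \<xi> p"
  \<comment> \<open>The outer \<open>\<phi>\<close> is also applied to a field, so both summands are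
    visibly values of vector fields; \<open>on_field_apply\<close> would destroy this form and is
    switched off for the span argument.\<close>
  have cov: "cov_endo nabla \<phi> X (\<phi> \<odot> Y) p
      = nabla X (\<phi> \<odot> \<phi> \<odot> Y) p - (\<phi> \<odot> nabla X (\<phi> \<odot> Y)) p"
    by (simp add: cov_endo_def)
  have "cov_endo nabla \<phi> X (\<phi> \<odot> Y) p \<in> span ?S"
    unfolding cov using X Y by (intro span_diff base) (simp_all del: on_field_apply)
  from this base[OF xi_VF] base[OF nabla_VF[OF X xi_VF]] have "V \<in> span ?S"
    unfolding V_def by (intro span_add span_diff span_scale)
  moreover have "g p V (Z p) = g p W (Z p)" if "Z \<in> VF" for Z
  proof -
    have "cov_endo nabla \<phi> X (\<phi> \<odot> Y) p \<in> T p"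
      unfolding cov using X Y by simp
    \<comment> \<open>Only the value of \<open>F\<close> at \<open>\<phi> \<odot> Y\<close> and
      \<open>Z\<close> is unfolded; the values at \<open>\<xi>\<close> stay folded, to match
      \<open>g_nabla_xi\<close> and \<open>cov_form_eta\<close>.\<close>
    then show ?thesis
      using X Y that
      by (simp add: V_def eq natural_difference_def g_nabla_xi cov_form_eta
          fundamental_tensor_def[of \<phi> g nabla X "\<phi> \<odot> Y" Z] algebra_simps)
  qed
  ultimately have "V = W"
    using W by (intro eq_by_metric)
  then show ?thesis
    by (simp add: first_natural_connection_def V_def algebra_simps)
qed

section \<open>The difference tensor in each main class\<close>

text \<open>Here F(x, \<xi>, z) = 0, so only half of F(x, \<phi>y, z) survives, which turns the
  factor 1/(2n) into 1/(4n).\<close>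

lemma first_natural_connection_F1:
  assumes F1: "class_F1 A n \<phi> \<xi> \<eta> g nabla"
    and "\<theta> = lee_theta A n \<phi> \<xi> \<eta> g nabla"
    and sharp: "is_sharp A g \<theta> W" and X: "X \<in> VF" and Y: "Y \<in> VF"
  shows "first_natural_connection \<phi> \<xi> \<eta> nabla X Y p = nabla X Y p - (1 / (4 * real n)) *\<^sub>R
    (\<theta> (\<phi> \<odot> Y) p *\<^sub>R \<phi> p (\<phi> p (X p)) - \<theta> (\<phi> \<odot> \<phi> \<odot> Y) p *\<^sub>R \<phi> p (X p)
     + g p (X p) (\<phi> p (Y p)) *\<^sub>R \<phi> p (\<phi> p (W p))
     - g p (\<phi> p (X p)) (\<phi> p (Y p)) *\<^sub>R \<phi> p (W p))"
    (is "_ = _ - ?W")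
proof (rule first_natural_connectionI[OF X Y])
  have W: "W \<in> VF" and theta: "\<And>Z. Z \<in> VF \<Longrightarrow> \<theta> Z p = g p (W p) (Z p)"
    using sharp by (simp_all add: is_sharp_def)
  have "?W = (1 / (4 * real n)) *\<^sub>R
      (\<theta> (\<phi> \<odot> Y) p *\<^sub>R (\<phi> \<odot> \<phi> \<odot> X) p - \<theta> (\<phi> \<odot> \<phi> \<odot> Y) p *\<^sub>R (\<phi> \<odot> X) p
       + g p (X p) (\<phi> p (Y p)) *\<^sub>R (\<phi> \<odot> \<phi> \<odot> W) p
       - g p (\<phi> p (X p)) (\<phi> p (Y p)) *\<^sub>R (\<phi> \<odot> W) p)"
    by simp
  also have "\<dots> \<in> span {X p |X. X \<in> VF}"
    using X W by (intro span_add span_diff span_scale span_base) (auto simp del: on_field_apply)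
  finally show "?W \<in> span {X p |X. X \<in> VF}" .
  fix Z assume Z: "Z \<in> VF"
  \<comment> \<open>The dual field \<open>W\<close> replaces the values of \<open>\<theta>\<close>
    by metric products. The arguments stay general because \<open>natural_difference\<close>
    evaluates \<open>F\<close> at three different pairs.\<close>
  have F: "F X Y' Z' p = 1 / (2 * real n) *
      (g p (\<phi> p (X p)) (\<phi> p (Y' p)) * g p (W p) (\<phi> p (\<phi> p (Z' p)))
     + g p (\<phi> p (X p)) (\<phi> p (Z' p)) * g p (W p) (\<phi> p (\<phi> p (Y' p)))
     - g p (X p) (\<phi> p (Y' p)) * g p (W p) (\<phi> p (Z' p))
     - g p (X p) (\<phi> p (Z' p)) * g p (W p) (\<phi> p (Y' p)))"
    if "Y' \<in> VF" "Z' \<in> VF" for Y' Z'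
    using F1[unfolded class_F1_def Let_def, folded assms(2)] X that by (simp add: theta)
  show "g p ?W (Z p) = natural_difference X Y Z p"
    using X Y Z W
    by (simp add: natural_difference_def F theta g_phi_left algebra_simps
        add_divide_distrib diff_divide_distrib)
qed

text \<open>The terms F(x, \<phi>y, z) and F(x, \<xi>, \<phi>y)\<eta>(z) coincide, both being a
  multiple of g(x, \<phi>y)\<eta>(z), so their halves add up to the \<open>\<xi>\<close>-term; the
  remaining summand yields \<eta>(y)\<phi>x.\<close>

lemma first_natural_connection_F4:
  assumes F4: "class_F4 A n \<phi> \<xi> \<eta> g nabla"
    and "\<theta> = lee_theta A n \<phi> \<xi> \<eta> g nabla" and X: "X \<in> VF" and Y: "Y \<in> VF"
  shows "first_natural_connection \<phi> \<xi> \<eta> nabla X Y p = nabla X Y p -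
    (1 / (2 * real n) * \<theta> \<xi> p) *\<^sub>R (g p (X p) (\<phi> p (Y p)) *\<^sub>R \<xi> p - \<eta> p (Y p) *\<^sub>R \<phi> p (X p))"
    (is "_ = _ - ?W")
proof (rule first_natural_connectionI[OF X Y])
  have "?W = (1 / (2 * real n) * \<theta> \<xi> p) *\<^sub>R
      (g p (X p) (\<phi> p (Y p)) *\<^sub>R \<xi> p - \<eta> p (Y p) *\<^sub>R (\<phi> \<odot> X) p)"
    by simp
  also have "\<dots> \<in> span {X p |X. X \<in> VF}"
    using X xi_VF by (intro span_diff span_scale span_base) (auto simp del: on_field_apply)
  finally show "?W \<in> span {X p |X. X \<in> VF}" .
  fix Z assume Z: "Z \<in> VF"
  have F: "F X Y' Z' p = \<theta> \<xi> p / (2 * real n) *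
      (g p (\<phi> p (X p)) (\<phi> p (Y' p)) * \<eta> p (Z' p) + g p (\<phi> p (X p)) (\<phi> p (Z' p)) * \<eta> p (Y' p))"
    if "Y' \<in> VF" "Z' \<in> VF" for Y' Z'
    using F4 X that assms(2) by (simp add: class_F4_def)
  show "g p ?W (Z p) = natural_difference X Y Z p"
    using X Y Z by (simp add: natural_difference_def F g_phi_left field_simps)
qed

text \<open>The same two terms coincide again, now as multiples of g(\<phi>x, \<phi>y)\<eta>(z). The
  extra \<open>\<phi>\<close> in the class condition turns \<phi>x into its second iterate.\<close>

lemma first_natural_connection_F5:
  assumes F5: "class_F5 A n \<phi> \<xi> \<eta> g nabla"
    and "\<theta>s = lee_theta_star A n \<phi> \<xi> \<eta> g nabla" and X: "X \<in> VF" and Y: "Y \<in> VF"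
  shows "first_natural_connection \<phi> \<xi> \<eta> nabla X Y p = nabla X Y p -
    (1 / (2 * real n) * \<theta>s \<xi> p) *\<^sub>R
      (g p (\<phi> p (X p)) (\<phi> p (Y p)) *\<^sub>R \<xi> p - \<eta> p (Y p) *\<^sub>R \<phi> p (\<phi> p (X p)))"
    (is "_ = _ - ?W")
proof (rule first_natural_connectionI[OF X Y])
  have "?W = (1 / (2 * real n) * \<theta>s \<xi> p) *\<^sub>R
      (g p (\<phi> p (X p)) (\<phi> p (Y p)) *\<^sub>R \<xi> p - \<eta> p (Y p) *\<^sub>R (\<phi> \<odot> \<phi> \<odot> X) p)"
    by simp
  also have "\<dots> \<in> span {X p |X. X \<in> VF}"
    using X xi_VF by (intro span_diff span_scale span_base) (auto simp del: on_field_apply)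
  finally show "?W \<in> span {X p |X. X \<in> VF}" .
  fix Z assume Z: "Z \<in> VF"
  have F: "F X Y' Z' p = \<theta>s \<xi> p / (2 * real n) *
      (g p (X p) (\<phi> p (Y' p)) * \<eta> p (Z' p) + g p (X p) (\<phi> p (Z' p)) * \<eta> p (Y' p))"
    if "Y' \<in> VF" "Z' \<in> VF" for Y' Z'
    using F5 X that assms(2) by (simp add: class_F5_def)
  show "g p ?W (Z p) = natural_difference X Y Z p"
    using X Y Z by (simp add: natural_difference_def F g_phi_left field_simps)
qed

text \<open>Since \<eta>(\<phi>y) = 0, both halves equal \<eta>(x)\<omega>(\<phi>y)\<eta>(z)/2, and
  F(x, \<xi>, \<phi>z) reduces to \<eta>(x)\<omega>(\<phi>z). Symmetry of \<open>\<phi>\<close>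
  moves it onto the dual field \<open>W\<close>.\<close>

lemma first_natural_connection_F11:
  assumes F11: "class_F11 A \<phi> \<xi> \<eta> g nabla"
    and "\<omega> = lee_omega \<phi> \<xi> g nabla"
    and sharp: "is_sharp A g \<omega> W" and X: "X \<in> VF" and Y: "Y \<in> VF"
  shows "first_natural_connection \<phi> \<xi> \<eta> nabla X Y p = nabla X Y p -
    \<eta> p (X p) *\<^sub>R (\<omega> (\<phi> \<odot> Y) p *\<^sub>R \<xi> p - \<eta> p (Y p) *\<^sub>R \<phi> p (W p))"
    (is "_ = _ - ?W")
proof (rule first_natural_connectionI[OF X Y])
  have W: "W \<in> VF" and omega: "\<And>Z. Z \<in> VF \<Longrightarrow> \<omega> Z p = g p (W p) (Z p)"
    using sharp by (simp_all add: is_sharp_def)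
  have "?W = \<eta> p (X p) *\<^sub>R (\<omega> (\<phi> \<odot> Y) p *\<^sub>R \<xi> p - \<eta> p (Y p) *\<^sub>R (\<phi> \<odot> W) p)"
    by simp
  also have "\<dots> \<in> span {X p |X. X \<in> VF}"
    using W xi_VF by (intro span_diff span_scale span_base) (auto simp del: on_field_apply)
  finally show "?W \<in> span {X p |X. X \<in> VF}" .
  fix Z assume Z: "Z \<in> VF"
  have F: "F X Y' Z' p = \<eta> p (X p) *
      (\<eta> p (Y' p) * g p (W p) (Z' p) + \<eta> p (Z' p) * g p (W p) (Y' p))"
    if "Y' \<in> VF" "Z' \<in> VF" for Y' Z'
    using F11[unfolded class_F11_def Let_def, folded assms(2)] X that by (simp add: omega)
  show "g p ?W (Z p) = natural_difference X Y Z p"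
    using X Y Z W by (simp add: natural_difference_def F omega g_phi_left field_simps)
qed

end

theorem theorem4p2:
  fixes A :: "('a::{second_countable_topology, t2_space}, 'e::euclidean_space) atlas"
    and n :: nat
    and \<phi> :: "'a \<Rightarrow> 'a tangent \<Rightarrow> 'a tangent"
    and \<xi> :: "'a vfield"
    and \<eta> :: "'a \<Rightarrow> 'a tangent \<Rightarrow> real"
    and g :: "'a \<Rightarrow> 'a tangent \<Rightarrow> 'a tangent \<Rightarrow> real"
    and nabla D :: "'a connection"
    and \<theta> \<theta>s \<omega> :: "'a vfield \<Rightarrow> 'a \<Rightarrow> real"
  assumes Pi: "riemannian_Pi_manifold A n \<phi> \<xi> \<eta> g"
    and LC: "levi_civita A g nabla"
    and D: "D = first_natural_connection \<phi> \<xi> \<eta> nabla"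
    and theta: "\<theta> = lee_theta A n \<phi> \<xi> \<eta> g nabla"
    and theta_star: "\<theta>s = lee_theta_star A n \<phi> \<xi> \<eta> g nabla"
    and omega: "\<omega> = lee_omega \<phi> \<xi> g nabla"
    and main_class: "class_F1 A n \<phi> \<xi> \<eta> g nabla \<or> class_F4 A n \<phi> \<xi> \<eta> g nabla \<or>
                     class_F5 A n \<phi> \<xi> \<eta> g nabla \<or> class_F11 A \<phi> \<xi> \<eta> g nabla"
  shows "\<forall>x\<in>vector_fields A. \<forall>y\<in>vector_fields A.
    (class_F1 A n \<phi> \<xi> \<eta> g nabla \<longrightarrow>
      (\<forall>\<theta>sharp. is_sharp A g \<theta> \<theta>sharp \<longrightarrow>
        D x y = (\<lambda>p. nabla x y p - (1 / (4 * real n)) *\<^sub>R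
          (\<theta> (\<phi> \<odot> y) p *\<^sub>R \<phi> p (\<phi> p (x p)) - \<theta> (\<phi> \<odot> \<phi> \<odot> y) p *\<^sub>R \<phi> p (x p)
           + g p (x p) (\<phi> p (y p)) *\<^sub>R \<phi> p (\<phi> p (\<theta>sharp p))
           - g p (\<phi> p (x p)) (\<phi> p (y p)) *\<^sub>R \<phi> p (\<theta>sharp p))))) \<and>
    (class_F4 A n \<phi> \<xi> \<eta> g nabla \<longrightarrow>
        D x y = (\<lambda>p. nabla x y p - (1 / (2 * real n) * \<theta> \<xi> p) *\<^sub>R
          (g p (x p) (\<phi> p (y p)) *\<^sub>R \<xi> p - \<eta> p (y p) *\<^sub>R \<phi> p (x p)))) \<and>
    (class_F5 A n \<phi> \<xi> \<eta> g nabla \<longrightarrow>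
        D x y = (\<lambda>p. nabla x y p - (1 / (2 * real n) * \<theta>s \<xi> p) *\<^sub>R
          (g p (\<phi> p (x p)) (\<phi> p (y p)) *\<^sub>R \<xi> p - \<eta> p (y p) *\<^sub>R \<phi> p (\<phi> p (x p))))) \<and>
    (class_F11 A \<phi> \<xi> \<eta> g nabla \<longrightarrow>
      (\<forall>\<omega>sharp. is_sharp A g \<omega> \<omega>sharp \<longrightarrow>
        D x y = (\<lambda>p. nabla x y p - \<eta> p (x p) *\<^sub>R
          (\<omega> (\<phi> \<odot> y) p *\<^sub>R \<xi> p - \<eta> p (y p) *\<^sub>R \<phi> p (\<omega>sharp p)))))"
proof -
  interpret Pi_manifold A n \<phi> \<xi> \<eta> g nabla
    by standard (fact Pi, fact LC)
  show ?thesis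
    unfolding D
    by (intro ballI conjI impI allI; rule ext; rule first_natural_connection_F1[OF _ theta]
        first_natural_connection_F4[OF _ theta] first_natural_connection_F5[OF _ theta_star]
        first_natural_connection_F11[OF _ omega]) assumption+
qed

end
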